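(* Let $n \in \mathbb{N}^*$, $d \in \mathbb{N}$, let $a_j < b_j$ be real numbers for $j=1,\dots,n$, and let $\mathcal{P} = \{p_1,\dots,p_m\} \subset \mathbb{R}[x_1,\dots,x_n]$ be a set of polynomials with $\deg(p_i) \le d$ for all $i$. For every polynomial $f \in \mathbb{R}[x_1,\dots,x_n]$ which is nonnegative on the constrained hypercube $\mathcal{H}_{\mathcal{P}}$ there exists a degree $n+d$ SONC certificate.
   Context: $\mathbb{N}$ contains $0$, $\mathbb{N}^* = \mathbb{N}\setminus\{0\}$, and $[n]=\{1,\dots,n\}$. A circuit polynomial is a polynomial $f(\mathbf{x}) = \sum_{j=0}^r f_{\boldsymbol{\alpha}(j)} \mathbf{x}^{\boldsymbol{\alpha}(j)} + f_{\boldsymbol{\beta}} \mathbf{x}^{\boldsymbol{\beta}}$ in $\mathbb{R}[x_1,\dots,x_n]$ with $r \le n$, exponents $\boldsymbol{\alpha}(j),\boldsymbol{\beta} \in \mathbb{N}^n$, $f_{\boldsymbol{\alpha}(j)} > 0$, $f_{\boldsymbol{\beta}} \in \mathbb{R}$, such that the Newton polytope of $f$ is a simplex with vertices $\boldsymbol{\alpha}(0),\dots,\boldsymbol{\alpha}(r) \in (2\mathbb{N})^n$ and $\boldsymbol{\beta}$ lies in the (relative) interior of this simplex. Monomial squares $c\,\mathbf{x}^{\boldsymbol{\alpha}}$ with $c>0$ and $\boldsymbol{\alpha} \in (2\mathbb{N})^n$ count as nonnegative circuit polynomials. A circuit polynomial is nonnegative if it is nonnegative on all of $\mathbb{R}^n$.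 A SONC polynomial is a finite sum $\sum_i \mu_i q_i$ with $\mu_i \ge 0$ and $q_i$ nonnegative circuit polynomials. Let $g_j(\mathbf{x}) = (x_j-a_j)(x_j-b_j)$ for $j \in [n]$, and $$\mathcal{H}_{\mathcal{P}} = \{\mathbf{x} \in \mathbb{R}^n : g_j(\mathbf{x}) = 0 \text{ for } j \in [n],\ p(\mathbf{x}) \ge 0 \text{ for } p \in \mathcal{P}\},$$ the hypercube $\prod_{j=1}^n \{a_j,b_j\}$ constrained by $\mathcal{P}$. It is described by the inequality constraints $\pm g_j \ge 0$, the box constraints $x_j - a_j \ge 0$, $b_j - x_j \ge 0$ ($j \in [n]$), and $p_i \ge 0$ ($i\in[m]$). A degree $D$ SONC certificate for $f$ (on $\mathcal{H}_{\mathcal{P}}$) is a decomposition, for some $q \in \mathbb{N}^*$, $$f(\mathbf{x}) = \sum_{\text{finite}} s(\mathbf{x}) H^{(q)}(\mathbf{x}),$$ where each $s$ is a SONC polynomial, each $H^{(q)}$ is a product of $q$ polynomials from $\{1,\ \pm g_j,\ x_j-a_j,\ b_j-x_j,\ p_i : j\in[n],\ i\in[m]\}$, and $\deg\left(\sum_{\text{finite}} s(\mathbf{x}) H^{(q)}(\mathbf{x})\right) \le D$.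
   Formalization: The degree bound n+d is replaced by max(n+d, deg f): a degree n+d certificate is a polynomial identity that forces deg f ≤ n+d, so the claim fails for larger degree (e.g. n=1, d=0, f=x²); for deg f ≤ n+d the bound is exactly n+d. *)

theory Defs
  imports "HOL-Analysis.Analysis" "HOL-Library.Poly_Mapping"
begin

text \<open>
  The polynomial ring in n variables is modelled by finitely supported maps from exponent
  vectors to real coefficients; the convolution product of \<^theory>\<open>HOL-Library.Poly_Mapping\<close>
  is polynomial multiplication. The variables are indexed by a finite type \<open>'n\<close>, so
  \<open>n = CARD('n) \<ge> 1\<close>.
\<close>

type_synonym 'n expo = "'n \<Rightarrow>\<^sub>0 nat"
type_synonym 'n rpoly = "'n expo \<Rightarrow>\<^sub>0 real"

abbreviation monom_poly :: "'n expo \<Rightarrow> real \<Rightarrow> 'n rpoly" where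
  "monom_poly \<alpha> c \<equiv> Poly_Mapping.single \<alpha> c"

definition const_poly :: "real \<Rightarrow> 'n rpoly" where
  "const_poly c = monom_poly 0 c"

definition var_poly :: "'n \<Rightarrow> 'n rpoly" where
  "var_poly j = monom_poly (Poly_Mapping.single j 1) 1"

definition eval_poly :: "'n::finite rpoly \<Rightarrow> real^'n \<Rightarrow> real" where
  "eval_poly f x =
     (\<Sum>\<alpha>\<in>Poly_Mapping.keys f.
        Poly_Mapping.lookup f \<alpha> * (\<Prod>i\<in>UNIV. (x $ i) ^ Poly_Mapping.lookup \<alpha> i))"

text \<open>The zero polynomial gets degree 0.\<close>

definition total_degree :: "'n::finite rpoly \<Rightarrow> nat" where
  "total_degree f =
     Max (insert 0 ((\<lambda>\<alpha>. \<Sum>i\<in>UNIV. Poly_Mapping.lookup \<alpha> i) ` Poly_Mapping.keys f))"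

definition expo_vec :: "'n::finite expo \<Rightarrow> real^'n" where
  "expo_vec \<alpha> = (\<chi> i. real (Poly_Mapping.lookup \<alpha> i))"

definition even_expo :: "'n expo \<Rightarrow> bool" where
  "even_expo \<alpha> \<longleftrightarrow> (\<forall>i. even (Poly_Mapping.lookup \<alpha> i))"

definition newton_polytope :: "'n::finite rpoly \<Rightarrow> (real^'n) set" where
  "newton_polytope f = convex hull (expo_vec ` Poly_Mapping.keys f)"

text \<open>
  The \<open>r + 1\<close> exponents \<open>\<alpha> 0, \<dots>, \<alpha> r\<close> are automatically distinct, since an r-simplex has
  exactly \<open>r + 1\<close> vertices. For \<open>r = 0\<close> the relative interior of the simplex is the point itself,
  so \<open>\<beta> = \<alpha> 0\<close>.
\<close>

definition circuit_poly :: "'n::finite rpoly \<Rightarrow> bool" where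
  "circuit_poly f \<longleftrightarrow>
     (\<exists>(r::nat) (\<alpha> :: nat \<Rightarrow> 'n expo) (c :: nat \<Rightarrow> real) (\<beta> :: 'n expo) (b :: real).
        r \<le> CARD('n) \<and>
        (\<forall>j\<le>r. even_expo (\<alpha> j) \<and> c j > 0) \<and>
        f = (\<Sum>j\<le>r. monom_poly (\<alpha> j) (c j)) + monom_poly \<beta> b \<and>
        int r simplex newton_polytope f \<and>
        {v. v extreme_point_of newton_polytope f} = (\<lambda>j. expo_vec (\<alpha> j)) ` {..r} \<and>
        expo_vec \<beta> \<in> rel_interior (newton_polytope f))"

definition monomial_square :: "'n rpoly \<Rightarrow> bool" where
  "monomial_square f \<longleftrightarrow> (\<exists>\<alpha> c. c > 0 \<and> even_expo \<alpha> \<and> f = monom_poly \<alpha> c)"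

definition nonneg_circuit_poly :: "'n::finite rpoly \<Rightarrow> bool" where
  "nonneg_circuit_poly f \<longleftrightarrow>
     monomial_square f \<or> (circuit_poly f \<and> (\<forall>x. eval_poly f x \<ge> 0))"

definition sonc :: "'n::finite rpoly \<Rightarrow> bool" where
  "sonc f \<longleftrightarrow>
     (\<exists>(k::nat) (\<mu> :: nat \<Rightarrow> real) (q :: nat \<Rightarrow> 'n rpoly).
        (\<forall>i<k. \<mu> i \<ge> 0 \<and> nonneg_circuit_poly (q i)) \<and>
        f = (\<Sum>i<k. const_poly (\<mu> i) * q i))"

definition cube_poly :: "real^'n \<Rightarrow> real^'n \<Rightarrow> 'n::finite \<Rightarrow> 'n rpoly" where
  "cube_poly a b j =
     (var_poly j - const_poly (a $ j)) * (var_poly j - const_poly (b $ j))"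

definition constrained_hypercube ::
    "real^'n \<Rightarrow> real^'n \<Rightarrow> 'n::finite rpoly set \<Rightarrow> (real^'n) set" where
  "constrained_hypercube a b P =
     {x. (\<forall>j. eval_poly (cube_poly a b j) x = 0) \<and> (\<forall>p\<in>P. eval_poly p x \<ge> 0)}"

definition constraint_polys ::
    "real^'n \<Rightarrow> real^'n \<Rightarrow> 'n::finite rpoly set \<Rightarrow> 'n rpoly set" where
  "constraint_polys a b P =
     {1} \<union> range (cube_poly a b) \<union> range (\<lambda>j. - cube_poly a b j)
     \<union> range (\<lambda>j. var_poly j - const_poly (a $ j))
     \<union> range (\<lambda>j. const_poly (b $ j) - var_poly j) \<union> P"

definition constraint_products ::
    "real^'n \<Rightarrow> real^'n \<Rightarrow> 'n::finite rpoly set \<Rightarrow> nat \<Rightarrow> 'n rpoly set" where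
  "constraint_products a b P q =
     {\<Prod>i<q. h i | h :: nat \<Rightarrow> 'n rpoly. \<forall>i<q. h i \<in> constraint_polys a b P}"

text \<open>
  The degree bound is imposed on the sum and on every single summand. The latter implies the
  former; the former alone would, because of \<open>f = (\<Sum>k<N. s k * H k)\<close>, say no more than that
  \<open>f\<close> has degree at most \<open>D\<close>.
\<close>

definition sonc_certificate ::
    "real^'n \<Rightarrow> real^'n \<Rightarrow> 'n::finite rpoly set \<Rightarrow> nat \<Rightarrow> 'n rpoly \<Rightarrow> bool" where
  "sonc_certificate a b P D f \<longleftrightarrow>
     (\<exists>q\<ge>1. \<exists>(N::nat) (s :: nat \<Rightarrow> 'n rpoly) (H :: nat \<Rightarrow> 'n rpoly).
        (\<forall>k<N. sonc (s k) \<and> H k \<in> constraint_products a b P q) \<and>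
        f = (\<Sum>k<N. s k * H k) \<and>
        total_degree (\<Sum>k<N. s k * H k) \<le> D \<and>
        (\<forall>k<N. total_degree (s k * H k) \<le> D))"

end

theory Submission
  imports Defs
begin

text \<open>
  On the cube, \<open>f\<close> agrees with its interpolant \<open>\<Sum>\<^sub>v f(v) \<delta>\<^sub>v\<close>, where \<open>\<delta>\<^sub>v\<close> is a positive multiple
  of a product of \<open>n\<close> box constraints. The difference is reduced to zero by the equations \<open>g\<^sub>j = 0\<close>
  without raising the degree; since both signs of \<open>g\<^sub>j\<close> are available and an odd power of \<open>x\<^sub>i\<close> can
  be written with \<open>x\<^sub>i = (x\<^sub>i - a\<^sub>i) + a\<^sub>i\<close>, every multiple of \<open>g\<^sub>j\<close> has a certificate whose summands
  have no larger degree. If \<open>f(v) < 0\<close>, some \<open>p \<in> P\<close> has \<open>p(v) < 0\<close>, and \<open>f(v) \<delta>\<^sub>v\<close> is congruent to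
  the certificate \<open>(f(v) / p(v)) p \<delta>\<^sub>v\<close> of degree at most \<open>n + d\<close>.
\<close>

section \<open>Degree and evaluation\<close>

abbreviation expo_degree :: "'n::finite expo \<Rightarrow> nat" where
  "expo_degree \<alpha> \<equiv> \<Sum>i\<in>UNIV. Poly_Mapping.lookup \<alpha> i"

lemma expo_degree_single [simp]: "expo_degree (Poly_Mapping.single i k) = k"
  by (simp add: lookup_single when_def)

lemma expo_degree_add: "expo_degree (\<alpha> + \<beta>) = expo_degree \<alpha> + expo_degree \<beta>"
  by (simp add: lookup_add sum.distrib)

section \<open>Degree bounds for sums and products\<close>

lemma total_degree_le_iff:
  "total_degree f \<le> D \<longleftrightarrow> (\<forall>\<alpha>\<in>Poly_Mapping.keys f. expo_degree \<alpha> \<le> D)"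
  by (auto simp: total_degree_def)

lemma expo_degree_le_total_degree:
  "\<alpha> \<in> Poly_Mapping.keys f \<Longrightarrow> expo_degree \<alpha> \<le> total_degree f"
  using total_degree_le_iff by blast

lemma total_degree_zero [simp]: "total_degree 0 = 0"
  by (simp add: total_degree_def)

lemma total_degree_add_le:
  "total_degree f \<le> D \<Longrightarrow> total_degree g \<le> D \<Longrightarrow> total_degree (f + g) \<le> D"
  unfolding total_degree_le_iff using keys_add[of f g] by blast

lemma total_degree_uminus [simp]: "total_degree (- f) = total_degree f"
proof -
  have "Poly_Mapping.keys (- f) = Poly_Mapping.keys f"
    by (auto simp: in_keys_iff)
  then show ?thesis by (simp add: total_degree_def)
qed

lemma total_degree_diff_le:
  "total_degree f \<le> D \<Longrightarrow> total_degree g \<le> D \<Longrightarrow> total_degree (f - g) \<le> D"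
  using total_degree_add_le[of f D "- g"] by simp

lemma total_degree_sum_le:
  "(\<And>i. i \<in> I \<Longrightarrow> total_degree (f i) \<le> D) \<Longrightarrow> total_degree (\<Sum>i\<in>I. f i) \<le> D"
  by (induction I rule: infinite_finite_induct) (auto intro: total_degree_add_le)

lemma total_degree_mult_le: "total_degree (f * g) \<le> total_degree f + total_degree g"
  unfolding total_degree_le_iff
proof
  fix \<gamma> assume "\<gamma> \<in> Poly_Mapping.keys (f * g)"
  then obtain \<alpha> \<beta> where "\<gamma> = \<alpha> + \<beta>" "\<alpha> \<in> Poly_Mapping.keys f" "\<beta> \<in> Poly_Mapping.keys g"
    using keys_mult[of f g] by blast
  then show "expo_degree \<gamma> \<le> total_degree f + total_degree g"
    by (simp add: expo_degree_add add_mono expo_degree_le_total_degree)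
qed

lemma total_degree_monom_le: "total_degree (monom_poly \<alpha> c) \<le> expo_degree \<alpha>"
  by (simp add: total_degree_le_iff)

lemma total_degree_const [simp]: "total_degree (const_poly c) = 0"
  using total_degree_monom_le[of 0 c] by (simp add: const_poly_def)

lemma total_degree_var_le: "total_degree (var_poly i) \<le> 1"
  using total_degree_monom_le[of "Poly_Mapping.single i 1" 1] by (simp add: var_poly_def)

lemma total_degree_prod_le:
  "(\<And>i. i \<in> I \<Longrightarrow> total_degree (f i) \<le> 1) \<Longrightarrow> total_degree (\<Prod>i\<in>I. f i) \<le> card I"
proof (induction I rule: infinite_finite_induct)
  case (insert i I)
  then have "total_degree (f i) + total_degree (\<Prod>i\<in>I. f i) \<le> 1 + card I"
    by (intro add_mono) auto
  with insert.hyps show ?case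
    using total_degree_mult_le[of "f i" "\<Prod>i\<in>I. f i"] by simp
qed (auto simp: total_degree_def)

lemma sum_monom_poly: "(\<Sum>\<alpha>\<in>Poly_Mapping.keys f. monom_poly \<alpha> (Poly_Mapping.lookup f \<alpha>)) = f"
proof (rule poly_mapping_eqI)
  fix \<beta>
  have "(\<Sum>\<alpha>\<in>Poly_Mapping.keys f. Poly_Mapping.lookup f \<alpha> when \<alpha> = \<beta>) =
      (\<Sum>\<alpha>\<in>Poly_Mapping.keys f. if \<alpha> = \<beta> then Poly_Mapping.lookup f \<beta> else 0)"
    by (rule sum.cong) (auto simp: when_def)
  also have "\<dots> = Poly_Mapping.lookup f \<beta>"
    by (simp add: in_keys_iff)
  finally show "Poly_Mapping.lookup (\<Sum>\<alpha>\<in>Poly_Mapping.keys f.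
      monom_poly \<alpha> (Poly_Mapping.lookup f \<alpha>)) \<beta> = Poly_Mapping.lookup f \<beta>"
    by (simp add: lookup_sum lookup_single)
qed

section \<open>Evaluation at a point as a ring homomorphism\<close>

lemma eval_monom:
  "eval_poly (monom_poly \<alpha> c) x = c * (\<Prod>i\<in>UNIV. (x $ i) ^ Poly_Mapping.lookup \<alpha> i)"
  by (simp add: eval_poly_def)

lemma eval_add: "eval_poly (f + g) x = eval_poly f x + eval_poly g x"
  unfolding eval_poly_def by (rule setsum_keys_plus_distrib) (auto simp: algebra_simps)

lemma eval_zero [simp]: "eval_poly 0 x = 0"
  by (simp add: eval_poly_def)

lemma eval_sum: "eval_poly (\<Sum>i\<in>I. f i) x = (\<Sum>i\<in>I. eval_poly (f i) x)"
  by (induction I rule: infinite_finite_induct) (auto simp: eval_add)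

lemma eval_diff: "eval_poly (f - g) x = eval_poly f x - eval_poly g x"
  using eval_add[of "f - g" g x] by simp

text \<open>Both factors are expanded into monomials, where the claim is the power law for each
  variable.\<close>

lemma eval_mult: "eval_poly (f * g) x = eval_poly f x * eval_poly g x"
proof -
  let ?m = "\<lambda>f \<alpha>. monom_poly \<alpha> (Poly_Mapping.lookup f \<alpha>)"
  have *: "eval_poly (?m f \<alpha> * ?m g \<beta>) x = eval_poly (?m f \<alpha>) x * eval_poly (?m g \<beta>) x" for \<alpha> \<beta>
    by (simp add: mult_single eval_monom lookup_add power_add prod.distrib)
  have "eval_poly ((\<Sum>\<alpha>\<in>Poly_Mapping.keys f. ?m f \<alpha>) * (\<Sum>\<beta>\<in>Poly_Mapping.keys g. ?m g \<beta>)) x =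
      eval_poly (\<Sum>\<alpha>\<in>Poly_Mapping.keys f. ?m f \<alpha>) x * eval_poly (\<Sum>\<beta>\<in>Poly_Mapping.keys g. ?m g \<beta>) x"
    by (simp add: sum_product eval_sum *)
  then show ?thesis by (simp only: sum_monom_poly)
qed

lemma eval_const [simp]: "eval_poly (const_poly c) x = c"
  by (simp add: const_poly_def eval_monom)

lemma eval_one [simp]: "eval_poly 1 x = 1"
  using eval_const[of 1 x] by (simp add: const_poly_def)

lemma eval_prod: "eval_poly (\<Prod>i\<in>I. f i) x = (\<Prod>i\<in>I. eval_poly (f i) x)"
  by (induction I rule: infinite_finite_induct) (auto simp: eval_mult)

lemma eval_var [simp]: "eval_poly (var_poly i) x = x $ i"
proof -
  have "(\<Prod>j\<in>UNIV. (x $ j) ^ Poly_Mapping.lookup (Poly_Mapping.single i 1) j) =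
      (\<Prod>j\<in>UNIV. if i = j then x $ j else 1)"
    by (rule prod.cong) (auto simp: lookup_single when_def)
  then show ?thesis by (simp add: var_poly_def eval_monom)
qed

section \<open>Constants, and monomials as products of one-variable powers\<close>

lemma const_poly_mult: "const_poly (c * d) = const_poly c * const_poly d"
  by (simp add: const_poly_def mult_single)

lemma const_poly_add: "const_poly (c + d) = const_poly c + const_poly d"
  by (simp add: const_poly_def single_add)

lemma const_poly_uminus: "const_poly (- c) = - const_poly c"
  by (simp add: const_poly_def single_uminus)

lemma const_poly_diff: "const_poly (c - d) = const_poly c - const_poly d"
  by (simp add: const_poly_def single_diff)

lemma const_poly_0 [simp]: "const_poly 0 = 0"
  by (simp add: const_poly_def)

lemma const_poly_1 [simp]: "const_poly 1 = 1"
  by (simp add: const_poly_def)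

lemma const_poly_prod: "const_poly (\<Prod>i\<in>I. c i) = (\<Prod>i\<in>I. const_poly (c i))"
  by (induction I rule: infinite_finite_induct) (auto simp: const_poly_mult)

text \<open>Separates the variables, so that interpolation of a multilinear monomial can be checked
  one variable at a time.\<close>

lemma monom_poly_eq_prod:
  fixes \<alpha> :: "'n::finite expo"
  shows "monom_poly \<alpha> 1 = (\<Prod>i\<in>UNIV. monom_poly (Poly_Mapping.single i (Poly_Mapping.lookup \<alpha> i)) 1)"
proof -
  have *: "(\<Prod>i\<in>I. monom_poly (\<gamma> i) (1::real)) = monom_poly (\<Sum>i\<in>I. \<gamma> i) 1"
    if "finite I" for I and \<gamma> :: "'n \<Rightarrow> 'n expo"
    using that by (induction I rule: finite_induct) (auto simp: mult_single)
  have "(\<Sum>i\<in>UNIV. Poly_Mapping.single i (Poly_Mapping.lookup \<alpha> i)) = \<alpha>"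
    by (rule poly_mapping_eqI) (simp add: lookup_sum lookup_single when_def)
  then show ?thesis by (simp add: *)
qed

section \<open>Closure properties of certificates\<close>

text \<open>The constant 1 is a constraint polynomial, so a product can be padded. This brings
  certificates with different numbers of factors to a common \<open>q\<close>.\<close>

lemma constraint_products_mono:
  assumes "H \<in> constraint_products a b P q" "q \<le> q'"
  shows "H \<in> constraint_products a b P q'"
proof -
  obtain h where h: "H = (\<Prod>i<q. h i)" "\<forall>i<q. h i \<in> constraint_polys a b P"
    using assms(1) by (auto simp: constraint_products_def)
  have "{..<q'} \<inter> {i. i < q} = {..<q}"
    using assms(2) by auto
  then have "H = (\<Prod>i<q'. if i < q then h i else 1)"
    using h(1) by (simp add: prod.If_cases)
  moreover have "\<forall>i<q'. (if i < q then h i else 1) \<in> constraint_polys a b P"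
    using h(2) by (auto simp: constraint_polys_def)
  ultimately show ?thesis
    unfolding constraint_products_def by (intro CollectI exI[of _ "\<lambda>i. if i < q then h i else 1"]) auto
qed

lemma constraint_products_mult:
  assumes "H \<in> constraint_products a b P q" "g \<in> constraint_polys a b P"
  shows "g * H \<in> constraint_products a b P (Suc q)"
proof -
  obtain h where h: "H = (\<Prod>i<q. h i)" "\<forall>i<q. h i \<in> constraint_polys a b P"
    using assms(1) by (auto simp: constraint_products_def)
  have "g * H = (\<Prod>i<Suc q. (h(q := g)) i)"
    by (simp add: h(1) mult.commute)
  moreover have "\<forall>i<Suc q. (h(q := g)) i \<in> constraint_polys a b P"
    using h(2) assms(2) by (auto simp: less_Suc_eq)
  ultimately show ?thesis
    unfolding constraint_products_def by (intro CollectI exI[of _ "h(q := g)"]) auto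
qed

lemma one_in_constraint_products: "1 \<in> constraint_products a b P 0"
  by (auto simp: constraint_products_def)

lemma prod_in_constraint_products:
  assumes "finite I" "\<And>i. i \<in> I \<Longrightarrow> h i \<in> constraint_polys a b P"
  shows "(\<Prod>i\<in>I. h i) \<in> constraint_products a b P (card I)"
  using assms
  by (induction I rule: finite_induct)
     (auto simp: one_in_constraint_products intro: constraint_products_mult)

text \<open>A monomial square needs a positive coefficient; placing \<open>c\<close> in the weight
  \<open>\<mu>\<close> also covers \<open>c = 0\<close>.\<close>

lemma sonc_monom:
  assumes "even_expo \<alpha>" "c \<ge> 0"
  shows "sonc (monom_poly \<alpha> c)"
proof -
  have "nonneg_circuit_poly (monom_poly \<alpha> 1)"
    using assms(1) zero_less_one unfolding nonneg_circuit_poly_def monomial_square_def by blast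
  moreover have "monom_poly \<alpha> c = const_poly c * monom_poly \<alpha> 1"
    by (simp add: const_poly_def mult_single)
  ultimately show ?thesis
    unfolding sonc_def using assms(2)
    by (intro exI[of _ "1::nat"] exI[of _ "\<lambda>_. c"] exI[of _ "\<lambda>_. monom_poly \<alpha> 1"]) auto
qed

section \<open>Certificates of bounded degree: single products and finite sums\<close>

lemma sonc_certificate_zero: "sonc_certificate a b P D 0"
  unfolding sonc_certificate_def by (intro exI[of _ "1::nat"] exI[of _ "0::nat"] conjI) auto

lemma sonc_certificate_product:
  assumes "sonc s" "H \<in> constraint_products a b P q" "total_degree (s * H) \<le> D"
  shows "sonc_certificate a b P D (s * H)"
  unfolding sonc_certificate_def
  using assms constraint_products_mono[OF assms(2), of "Suc q"]
  \<comment> \<open>\<open>Suc q\<close> instead of \<open>q\<close>, because \<open>q\<close> may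
    be 0 while a certificate requires at least one factor.\<close>
  by (intro exI[of _ "Suc q"] exI[of _ "1::nat"] exI[of _ "\<lambda>_. s"] exI[of _ "\<lambda>_. H"] conjI) auto

text \<open>The two lists of summands are concatenated, after padding all products to
  \<open>max q q'\<close> factors.\<close>

lemma sonc_certificate_add:
  assumes "sonc_certificate a b P D f" "sonc_certificate a b P D g"
  shows "sonc_certificate a b P D (f + g)"
proof -
  obtain q and N :: nat and s H where 1: "q \<ge> (1::nat)" "\<forall>k<N. sonc (s k) \<and> H k \<in> constraint_products a b P q"
      "f = (\<Sum>k<N. s k * H k)" "\<forall>k<N. total_degree (s k * H k) \<le> D"
    using assms(1) unfolding sonc_certificate_def by blast
  obtain q' and N' :: nat and s' H' where 2: "q' \<ge> (1::nat)"
      "\<forall>k<N'. sonc (s' k) \<and> H' k \<in> constraint_products a b P q'"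
      "g = (\<Sum>k<N'. s' k * H' k)" "\<forall>k<N'. total_degree (s' k * H' k) \<le> D"
    using assms(2) unfolding sonc_certificate_def by blast
  define t where "t k = (if k < N then s k else s' (k - N))" for k
  define K where "K k = (if k < N then H k else H' (k - N))" for k
  have split: "(\<Sum>k<N + M. h k) = (\<Sum>k<N. h k) + (\<Sum>k<M. h (N + k))" for M and h :: "nat \<Rightarrow> 'a rpoly"
    by (induction M) (auto simp: add.assoc)
  have 3: "\<forall>k<N + N'. sonc (t k) \<and> K k \<in> constraint_products a b P (max q q')"
    using 1(2) 2(2)
    by (auto simp: t_def K_def intro: constraint_products_mono[OF _ max.cobounded1]
        constraint_products_mono[OF _ max.cobounded2])
  have 4: "f + g = (\<Sum>k<N + N'. t k * K k)"
    by (simp add: split 1(3) 2(3) t_def K_def)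
  have 5: "\<forall>k<N + N'. total_degree (t k * K k) \<le> D"
    using 1(4) 2(4) by (auto simp: t_def K_def)
  then have 6: "total_degree (\<Sum>k<N + N'. t k * K k) \<le> D"
    by (intro total_degree_sum_le) auto
  have "max q q' \<ge> 1" using 1(1) by simp
  with 3 4 5 6 show ?thesis
    unfolding sonc_certificate_def by blast
qed

lemma sonc_certificate_sum:
  "(\<And>i. i \<in> I \<Longrightarrow> sonc_certificate a b P D (f i)) \<Longrightarrow> sonc_certificate a b P D (\<Sum>i\<in>I. f i)"
  by (induction I rule: infinite_finite_induct)
     (auto intro: sonc_certificate_zero sonc_certificate_add)

text \<open>Induction on the degree of \<alpha>. If \<alpha> is even, the sign of \<open>c\<close>
  is absorbed by the choice between \<open>H\<close> and \<open>- H\<close>. If x_i has odd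
  exponent, one factor x_i is split as (x_i - a_i) + a_i: the box constraint moves into the product,
  the constant into the coefficient. Both signs of the product stay available and the total degree
  does not grow. Since \<open>H\<close> and \<open>q\<close> change on the way, the induction
  generalises over them.\<close>

lemma sonc_certificate_monom_mult:
  assumes "H \<in> constraint_products a b P q" "- H \<in> constraint_products a b P q"
    and "expo_degree \<alpha> + total_degree H \<le> D"
  shows "sonc_certificate a b P D (monom_poly \<alpha> c * H)"
  using assms
proof (induction "expo_degree \<alpha>" arbitrary: \<alpha> c H q rule: less_induct)
  case less
  have deg: "total_degree (monom_poly \<alpha> e * H) \<le> D" for e
    using less.prems(3) total_degree_mult_le[of "monom_poly \<alpha> e" H] total_degree_monom_le[of \<alpha> e]
    by linarith
  show ?case
  proof (cases "even_expo \<alpha>")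
    case even: True
    show ?thesis
    proof (cases "c \<ge> 0")
      case True
      then show ?thesis
        using sonc_certificate_product[OF sonc_monom[OF even] less.prems(1)] deg by blast
    next
      case False
      have "monom_poly \<alpha> c * H = monom_poly \<alpha> (- c) * (- H)"
        by (simp add: single_uminus)
      then show ?thesis
        using sonc_certificate_product[OF sonc_monom[OF even, of "- c"] less.prems(2)] deg[of c] False
        by simp
    qed
  next
    case False
    then obtain i where i: "odd (Poly_Mapping.lookup \<alpha> i)"
      by (auto simp: even_expo_def)
    \<comment> \<open>Subtraction of exponents is truncated, but an odd exponent is at least 1, so
      nothing is lost here.\<close>
    define \<beta> where "\<beta> = \<alpha> - Poly_Mapping.single i 1"
    have \<alpha>: "\<alpha> = \<beta> + Poly_Mapping.single i 1"
      using odd_pos[OF i]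
      by (intro poly_mapping_eqI) (auto simp: \<beta>_def lookup_add lookup_minus lookup_single when_def)
    have deg_\<alpha>: "expo_degree \<alpha> = expo_degree \<beta> + 1"
      unfolding \<alpha> by (simp add: expo_degree_add)
    define g where "g = var_poly i - const_poly (a $ i)"
    have g: "g \<in> constraint_polys a b P"
      by (auto simp: constraint_polys_def g_def)
    have "total_degree g \<le> 1"
      unfolding g_def by (intro total_degree_diff_le total_degree_var_le) auto
    then have deg_g: "total_degree (g * H) \<le> 1 + total_degree H"
      using total_degree_mult_le[of g H] by linarith
    have "monom_poly \<alpha> c * H = monom_poly \<beta> c * (g * H) + monom_poly \<beta> (c * a $ i) * H"
      unfolding \<alpha> g_def var_poly_def const_poly_def
      by (simp add: algebra_simps mult_single flip: mult.assoc)
    moreover have "- (g * H) \<in> constraint_products a b P (Suc q)"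
      using constraint_products_mult[OF less.prems(2) g] by simp
    then have "sonc_certificate a b P D (monom_poly \<beta> c * (g * H))"
      using less.prems(3) deg_\<alpha> deg_g
      by (intro less.hyps[OF _ constraint_products_mult[OF less.prems(1) g]]) auto
    moreover have "sonc_certificate a b P D (monom_poly \<beta> (c * a $ i) * H)"
      using less.prems deg_\<alpha> by (intro less.hyps) auto
    ultimately show ?thesis
      by (simp add: sonc_certificate_add)
  qed
qed

section \<open>Interpolation at the vertices of the cube\<close>

text \<open>Subsets of the index type enumerate the vertices, which turns sums over vertices into
  sums over the power set.\<close>

definition vertex :: "real^'n \<Rightarrow> real^'n \<Rightarrow> 'n set \<Rightarrow> real^'n" where
  "vertex a b S = (\<chi> i. if i \<in> S then b $ i else a $ i)"

text \<open>The Lagrange basis polynomial of the vertex \<open>S\<close>, left unnormalised so that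
  it is literally a product of box constraints.\<close>

definition box_prod :: "real^'n \<Rightarrow> real^'n \<Rightarrow> 'n::finite set \<Rightarrow> 'n rpoly" where
  "box_prod a b S =
     (\<Prod>i\<in>UNIV. if i \<in> S then var_poly i - const_poly (a $ i) else const_poly (b $ i) - var_poly i)"

text \<open>The normalising factor of the Lagrange basis, the same for every vertex.\<close>

definition box_volume :: "real^'n::finite \<Rightarrow> real^'n \<Rightarrow> real" where
  "box_volume a b = (\<Prod>i\<in>UNIV. b $ i - a $ i)"

definition interp :: "real^'n \<Rightarrow> real^'n \<Rightarrow> 'n::finite rpoly \<Rightarrow> 'n rpoly" where
  "interp a b f =
     (\<Sum>S\<in>UNIV. const_poly (eval_poly f (vertex a b S) / box_volume a b) * box_prod a b S)"

lemma total_degree_box_prod: "total_degree (box_prod a b S) \<le> CARD('n)"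
  for S :: "'n::finite set"
  unfolding box_prod_def
  by (rule total_degree_prod_le) (auto intro!: total_degree_diff_le total_degree_var_le simp del: One_nat_def)

lemma box_prod_in_constraint_products:
  "box_prod a b S \<in> constraint_products a b P CARD('n)" for S :: "'n::finite set"
  unfolding box_prod_def
  by (rule prod_in_constraint_products) (auto simp: constraint_polys_def)

text \<open>At its own vertex every factor equals b_i - a_i; at another vertex, a coordinate in
  which the two sets differ makes a factor vanish.\<close>

lemma eval_box_prod_vertex:
  "eval_poly (box_prod a b S) (vertex a b T) = (if S = T then box_volume a b else 0)"
proof (cases "S = T")
  case True
  then show ?thesis
    unfolding box_prod_def box_volume_def eval_prod
    by (auto intro!: prod.cong simp: eval_diff vertex_def)
next
  case False
  then obtain i where "i \<in> S \<longleftrightarrow> i \<notin> T" by blast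
  then have "\<exists>i\<in>UNIV. eval_poly (if i \<in> S then var_poly i - const_poly (a $ i)
      else const_poly (b $ i) - var_poly i) (vertex a b T) = 0"
    by (intro bexI[of _ i]) (auto simp: eval_diff vertex_def)
  then show ?thesis
    using False unfolding box_prod_def eval_prod by (simp add: prod_zero_iff)
qed

section \<open>The interpolation operator: linearity and exactness on multilinear monomials\<close>

lemma interp_add: "interp a b (f + g) = interp a b f + interp a b g"
  by (simp add: interp_def eval_add add_divide_distrib const_poly_add ring_distribs sum.distrib)

lemma interp_zero [simp]: "interp a b 0 = 0"
  by (simp add: interp_def)

lemma interp_sum: "interp a b (\<Sum>i\<in>I. f i) = (\<Sum>i\<in>I. interp a b (f i))"
  by (induction I rule: infinite_finite_induct) (auto simp: interp_add)

text \<open>The product vanishes at all vertices except \<open>S\<close>, so one summand survives,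
  and there the volume cancels.\<close>

lemma interp_mult_box_prod:
  assumes "box_volume a b \<noteq> 0"
  shows "interp a b (p * box_prod a b S) =
    const_poly (eval_poly p (vertex a b S)) * box_prod a b S"
proof -
  have "interp a b (p * box_prod a b S) =
      (\<Sum>T\<in>UNIV. if S = T then const_poly (eval_poly p (vertex a b S)) * box_prod a b S else 0)"
    unfolding interp_def
    by (rule sum.cong) (use assms in \<open>auto simp: eval_mult eval_box_prod_vertex\<close>)
  then show ?thesis by simp
qed

text \<open>Linear interpolation in one variable at a_i and b_i reproduces 1 and x_i. Multiplying
  over all variables and expanding gives one summand per subset, which is exactly the
  interpolant.\<close>

lemma interp_multilinear:
  assumes "\<And>j. a $ j < b $ j" and "\<And>i. Poly_Mapping.lookup \<alpha> i \<le> 1"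
  shows "interp a b (monom_poly \<alpha> c) = monom_poly \<alpha> c"
proof -
  let ?k = "Poly_Mapping.lookup \<alpha>"
  \<comment> \<open>\<open>B i\<close> and \<open>A i\<close> are the two Lagrange terms, for the
    nodes b_i and a_i, of the power of x_i that occurs in the monomial.\<close>
  define B where "B i = const_poly ((b $ i) ^ ?k i / (b $ i - a $ i)) * (var_poly i - const_poly (a $ i))" for i
  define A where "A i = const_poly ((a $ i) ^ ?k i / (b $ i - a $ i)) * (const_poly (b $ i) - var_poly i)" for i
  have factor: "monom_poly (Poly_Mapping.single i (?k i)) 1 = B i + A i" for i
  proof -
    have nz: "b $ i - a $ i \<noteq> 0" using assms(1)[of i] by simp
    \<comment> \<open>Sorted by powers of x_i: exponent 0 leaves coefficients 0 and 1, exponent 1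
      leaves 1 and 0.\<close>
    have AB: "B i + A i =
        const_poly ((b $ i) ^ ?k i / (b $ i - a $ i) - (a $ i) ^ ?k i / (b $ i - a $ i)) * var_poly i +
        const_poly ((a $ i) ^ ?k i / (b $ i - a $ i) * b $ i - (b $ i) ^ ?k i / (b $ i - a $ i) * a $ i)"
      unfolding A_def B_def const_poly_diff const_poly_mult by (simp add: algebra_simps)
    consider "?k i = 0" | "?k i = 1" using assms(2)[of i] by linarith
    then show ?thesis
    proof cases
      case 1
      have "1 / (b $ i - a $ i) * b $ i - 1 / (b $ i - a $ i) * a $ i = 1"
        using nz by (simp flip: diff_divide_distrib)
      with 1 show ?thesis unfolding AB by simp
    next
      case 2
      have "b $ i / (b $ i - a $ i) - a $ i / (b $ i - a $ i) = 1"
        using nz by (simp flip: diff_divide_distrib)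
      with 2 show ?thesis unfolding AB by (simp add: var_poly_def mult.commute)
    qed
  qed
  have summand: "const_poly (eval_poly (monom_poly \<alpha> c) (vertex a b S) / box_volume a b) * box_prod a b S =
      const_poly c * ((\<Prod>i\<in>S. B i) * (\<Prod>i\<in>UNIV - S. A i))" for S
  proof -
    have "(\<Prod>i\<in>S. B i) * (\<Prod>i\<in>UNIV - S. A i) = (\<Prod>i\<in>UNIV. if i \<in> S then B i else A i)"
      by (simp add: prod.If_cases Compl_eq_Diff_UNIV)
    also have "\<dots> = (\<Prod>i\<in>UNIV. const_poly ((vertex a b S $ i) ^ ?k i / (b $ i - a $ i)) *
        (if i \<in> S then var_poly i - const_poly (a $ i) else const_poly (b $ i) - var_poly i))"
      by (rule prod.cong) (auto simp: A_def B_def vertex_def)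
    also have "\<dots> = const_poly (\<Prod>i\<in>UNIV. (vertex a b S $ i) ^ ?k i / (b $ i - a $ i)) * box_prod a b S"
      by (simp add: prod.distrib const_poly_prod box_prod_def)
    finally show ?thesis
      by (simp add: eval_monom box_volume_def prod_dividef flip: const_poly_mult mult.assoc)
  qed
  \<comment> \<open>\<open>prod_add\<close> expands a product of binary sums over all subsets, here
    over all vertices.\<close>
  have "interp a b (monom_poly \<alpha> c) = const_poly c * (\<Prod>i\<in>UNIV. B i + A i)"
    unfolding interp_def summand by (simp add: prod_add sum_distrib_left)
  also have "\<dots> = const_poly c * monom_poly \<alpha> 1"
    by (subst monom_poly_eq_prod) (simp add: factor)
  finally show ?thesis by (simp add: const_poly_def mult_single)
qed

section \<open>Reduction modulo the equations of the cube\<close>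

text \<open>As long as some exponent is at least 2, the identity x_i^2 = g_i + (a_i + b_i) x_i - a_i
  b_i yields a multiple of g_i and two monomials of smaller degree. The multiple of g_i has
  interpolant 0 and is certified by \<open>sonc_certificate_monom_mult\<close>. The recursion ends
  at multilinear monomials, which equal their interpolants.\<close>

lemma sonc_certificate_monom_diff_interp:
  assumes "\<And>j. a $ j < b $ j" and "expo_degree \<alpha> \<le> D"
  shows "sonc_certificate a b P D (monom_poly \<alpha> c - interp a b (monom_poly \<alpha> c))"
  using assms(2)
proof (induction "expo_degree \<alpha>" arbitrary: \<alpha> c rule: less_induct)
  case less
  show ?case
  proof (cases "\<forall>i. Poly_Mapping.lookup \<alpha> i \<le> 1")
    case True
    then show ?thesis
      using assms(1) by (simp add: interp_multilinear sonc_certificate_zero)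
  next
    case False
    then obtain i where i: "Poly_Mapping.lookup \<alpha> i \<ge> 2"
      by (auto simp: not_le numeral_2_eq_2 Suc_le_eq)
    define \<beta> where "\<beta> = \<alpha> - Poly_Mapping.single i 2"
    have \<alpha>: "\<alpha> = \<beta> + Poly_Mapping.single i 2"
      using i by (intro poly_mapping_eqI) (auto simp: \<beta>_def lookup_add lookup_minus lookup_single when_def)
    have deg_\<alpha>: "expo_degree \<alpha> = expo_degree \<beta> + 2"
      unfolding \<alpha> by (simp add: expo_degree_add)
    define \<gamma> where "\<gamma> = \<beta> + Poly_Mapping.single i 1"
    have deg_\<gamma>: "expo_degree \<gamma> = expo_degree \<beta> + 1"
      unfolding \<gamma>_def by (simp add: expo_degree_add)
    \<comment> \<open>\<open>F\<close> and \<open>G\<close> are the linear and the constant part of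
      the replacement for x_i^2, times the remaining monomial.\<close>
    define F where "F = monom_poly \<gamma> (c * (a $ i + b $ i))"
    define G where "G = monom_poly \<beta> (- (c * (a $ i * b $ i)))"
    define K where "K = cube_poly a b i"
    have sq: "Poly_Mapping.single i 2 = Poly_Mapping.single i 1 + Poly_Mapping.single i (1::nat)"
      by (simp add: numeral_2_eq_2 flip: single_add)
    have decomp: "monom_poly \<alpha> c = monom_poly \<beta> c * K + F + G"
      unfolding \<alpha> \<gamma>_def F_def G_def K_def cube_poly_def var_poly_def const_poly_def sq
      by (simp add: algebra_simps mult_single single_add single_uminus)
    have "eval_poly K (vertex a b S) = 0" for S
      by (simp add: K_def cube_poly_def eval_mult eval_diff vertex_def)
    then have "interp a b (monom_poly \<beta> c * K) = 0"
      by (simp add: interp_def eval_mult)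
    then have "monom_poly \<alpha> c - interp a b (monom_poly \<alpha> c) =
        monom_poly \<beta> c * K + ((F - interp a b F) + (G - interp a b G))"
      unfolding decomp by (simp add: interp_add)
    moreover have "sonc_certificate a b P D (monom_poly \<beta> c * K)"
    proof (rule sonc_certificate_monom_mult)
      show "K \<in> constraint_products a b P (Suc 0)" "- K \<in> constraint_products a b P (Suc 0)"
        using constraint_products_mult[OF one_in_constraint_products, of K a b P]
          constraint_products_mult[OF one_in_constraint_products, of "- K" a b P]
        by (auto simp: K_def constraint_polys_def)
      have "total_degree K \<le> 1 + 1"
        unfolding K_def cube_poly_def
        by (rule order_trans[OF total_degree_mult_le])
           (intro add_mono total_degree_diff_le total_degree_var_le; simp)
      then show "expo_degree \<beta> + total_degree K \<le> D"
        using deg_\<alpha> less.prems by linarith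
    qed
    moreover have "sonc_certificate a b P D (F - interp a b F)"
      unfolding F_def using deg_\<alpha> deg_\<gamma> less.prems by (intro less.hyps) auto
    moreover have "sonc_certificate a b P D (G - interp a b G)"
      unfolding G_def using deg_\<alpha> less.prems by (intro less.hyps) auto
    ultimately show ?thesis
      by (simp add: sonc_certificate_add)
  qed
qed

lemma sonc_certificate_diff_interp:
  assumes "\<And>j. a $ j < b $ j" and "total_degree f \<le> D"
  shows "sonc_certificate a b P D (f - interp a b f)"
proof -
  let ?m = "\<lambda>\<alpha>. monom_poly \<alpha> (Poly_Mapping.lookup f \<alpha>)"
  have "sonc_certificate a b P D (\<Sum>\<alpha>\<in>Poly_Mapping.keys f. ?m \<alpha> - interp a b (?m \<alpha>))"
    using assms by (intro sonc_certificate_sum sonc_certificate_monom_diff_interp)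
      (auto simp: total_degree_le_iff)
  then show ?thesis
    by (simp add: sum_subtractf sum_monom_poly flip: interp_sum)
qed

text \<open>A certificate is an identity of polynomials, so its degree bound cannot be below
  \<open>total_degree f\<close>; this is why the bound is a maximum. It equals n + d whenever
  \<open>f\<close> has degree at most n + d.\<close>

theorem corollary4p8:
  fixes a b :: "real^'n"
    and P :: "'n::finite rpoly set"
    and d :: nat
    and f :: "'n rpoly"
  assumes "\<And>j. a $ j < b $ j"
    and "finite P"
    and "\<And>p. p \<in> P \<Longrightarrow> total_degree p \<le> d"
    and "\<And>x. x \<in> constrained_hypercube a b P \<Longrightarrow> eval_poly f x \<ge> 0"
  shows "sonc_certificate a b P (max (CARD('n) + d) (total_degree f)) f"
proof -
  define D where "D = max (CARD('n) + d) (total_degree f)"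
  have vol: "box_volume a b > 0"
    unfolding box_volume_def using assms(1) by (intro prod_pos) simp
  have nonneg_mult: "sonc_certificate a b P D (const_poly c * H)"
    if "c \<ge> 0" "H \<in> constraint_products a b P q" "total_degree H \<le> D" for c H q
  proof (rule sonc_certificate_product)
    show "sonc (const_poly c)"
      unfolding const_poly_def using that(1) by (intro sonc_monom) (auto simp: even_expo_def)
    show "total_degree (const_poly c * H) \<le> D"
      using that(3) total_degree_mult_le[of "const_poly c" H] by simp
  qed (rule that(2))
  \<comment> \<open>Each Lagrange term of the interpolant is certified separately, according to the
    sign of \<open>f\<close> at the vertex.\<close>
  have vertex_term: "sonc_certificate a b P D
      (const_poly (eval_poly f (vertex a b S) / box_volume a b) * box_prod a b S)" for S
  proof (cases "eval_poly f (vertex a b S) \<ge> 0")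
    case True
    then show ?thesis
      using vol total_degree_box_prod[of a b S]
      by (intro nonneg_mult[OF _ box_prod_in_constraint_products]) (auto simp: D_def)
  next
    case False
    then have "vertex a b S \<notin> constrained_hypercube a b P"
      using assms(4) by blast
    moreover have "eval_poly (cube_poly a b j) (vertex a b S) = 0" for j
      by (simp add: cube_poly_def eval_mult eval_diff vertex_def)
    ultimately obtain p where p: "p \<in> P" "eval_poly p (vertex a b S) < 0"
      by (auto simp: constrained_hypercube_def not_le)
    \<comment> \<open>A quotient of two negative numbers, scaled so that \<open>t * p\<close> takes
      at the vertex the value of the coefficient to be replaced.\<close>
    define t where "t = eval_poly f (vertex a b S) / box_volume a b / eval_poly p (vertex a b S)"
    have t: "t \<ge> 0" "t * eval_poly p (vertex a b S) = eval_poly f (vertex a b S) / box_volume a b"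
      using False p(2) vol by (auto simp: t_def divide_nonpos_neg mult_pos_neg)
    \<comment> \<open>The sign is negative so that the correction between the Lagrange term and the
      certified product has the form \<open>G - interp a b G\<close>, which
      \<open>sonc_certificate_diff_interp\<close> covers.\<close>
    define G where "G = (const_poly (- t) * p) * box_prod a b S"
    have deg: "total_degree (p * box_prod a b S) \<le> D"
      using total_degree_mult_le[of p "box_prod a b S"] assms(3)[OF p(1)] total_degree_box_prod[of a b S]
      by (simp add: D_def)
    have "interp a b G = - (const_poly (eval_poly f (vertex a b S) / box_volume a b) * box_prod a b S)"
      unfolding G_def using vol t(2)
      by (simp add: interp_mult_box_prod eval_mult, simp add: const_poly_uminus)
    then have "const_poly (eval_poly f (vertex a b S) / box_volume a b) * box_prod a b S =
        const_poly t * (p * box_prod a b S) + (G - interp a b G)"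
      by (simp add: G_def const_poly_uminus mult.assoc)
    moreover have "sonc_certificate a b P D (const_poly t * (p * box_prod a b S))"
      using p(1) deg t(1)
      by (intro nonneg_mult[OF _ constraint_products_mult[OF box_prod_in_constraint_products]])
         (auto simp: constraint_polys_def)
    moreover have "sonc_certificate a b P D (G - interp a b G)"
      using deg total_degree_mult_le[of "const_poly (- t)" "p * box_prod a b S"] assms(1)
      by (intro sonc_certificate_diff_interp) (auto simp: G_def mult.assoc)
    ultimately show ?thesis
      by (simp add: sonc_certificate_add)
  qed
  have "sonc_certificate a b P D (f - interp a b f)"
    using assms(1) by (intro sonc_certificate_diff_interp) (auto simp: D_def)
  moreover have "sonc_certificate a b P D (interp a b f)"
    unfolding interp_def by (intro sonc_certificate_sum vertex_term)
  ultimately show ?thesis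
    using sonc_certificate_add[of a b P D "f - interp a b f" "interp a b f"] by (simp add: D_def)
qed

end
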